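(* (i) The maximum size of a set of mutually orthogoval affine planes of order $4$ (each isomorphic to $\mathrm{AG}(2,4)$) on a common point set is seven. (ii) There exists a set of seven mutually orthogoval affine planes of order $8$, each isomorphic to $\mathrm{AG}(2,8)$, on a common point set.
   Context: Two planes, both projective or both affine, of the same order and on the same point set are called orthogoval if every line of one plane intersects every line of the other plane in at most two points. A set of planes is a set of mutually orthogoval planes if the planes are pairwise orthogoval. *)

theory Defs
  imports "HOL-Algebra.Ring"
begin

record 'a plane =
  points :: "'a set"
  lines :: "'a set set"

definition linear_space :: "'a plane \<Rightarrow> bool" where
  "linear_space P \<longleftrightarrow>
     (\<forall>l\<in>lines P. l \<subseteq> points P) \<and>
     (\<forall>x\<in>points P. \<forall>y\<in>points P. x \<noteq> y \<longrightarrow> (\<exists>!l. l \<in> lines P \<and> x \<in> l \<and> y \<in> l))"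

definition affine_plane :: "'a plane \<Rightarrow> bool" where
  "affine_plane P \<longleftrightarrow>
     linear_space P \<and>
     (\<forall>l\<in>lines P. \<forall>x\<in>points P. x \<notin> l \<longrightarrow>
        (\<exists>!m. m \<in> lines P \<and> x \<in> m \<and> m \<inter> l = {})) \<and>
     (\<exists>x\<in>points P. \<exists>y\<in>points P. \<exists>z\<in>points P.
        x \<noteq> y \<and> x \<noteq> z \<and> y \<noteq> z \<and> \<not> (\<exists>l\<in>lines P. {x, y, z} \<subseteq> l))"

definition affine_plane_of_order :: "nat \<Rightarrow> 'a plane \<Rightarrow> bool" where
  "affine_plane_of_order n P \<longleftrightarrow>
     affine_plane P \<and> n \<ge> 2 \<and> (\<forall>l\<in>lines P. card l = n)"

definition projective_plane :: "'a plane \<Rightarrow> bool" where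
  "projective_plane P \<longleftrightarrow>
     linear_space P \<and>
     (\<forall>l\<in>lines P. \<forall>m\<in>lines P. l \<noteq> m \<longrightarrow> (\<exists>!x. x \<in> l \<and> x \<in> m)) \<and>
     (\<exists>S. S \<subseteq> points P \<and> card S = 4 \<and> (\<forall>l\<in>lines P. card (S \<inter> l) \<le> 2))"

definition projective_plane_of_order :: "nat \<Rightarrow> 'a plane \<Rightarrow> bool" where
  "projective_plane_of_order n P \<longleftrightarrow>
     projective_plane P \<and> n \<ge> 2 \<and> (\<forall>l\<in>lines P. card l = n + 1)"

text \<open>Lines of planes of a given order are finite, so the cardinality bound below is a
  genuine one.\<close>

definition orthogoval :: "'a plane \<Rightarrow> 'a plane \<Rightarrow> bool" where
  "orthogoval P Q \<longleftrightarrow>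
     points P = points Q \<and>
     (\<exists>n. affine_plane_of_order n P \<and> affine_plane_of_order n Q \<or>
          projective_plane_of_order n P \<and> projective_plane_of_order n Q) \<and>
     (\<forall>l\<in>lines P. \<forall>m\<in>lines Q. card (l \<inter> m) \<le> 2)"

definition mutually_orthogoval :: "'a plane set \<Rightarrow> bool" where
  "mutually_orthogoval \<P> \<longleftrightarrow> pairwise orthogoval \<P>"

definition mutually_orthogoval_affine_planes :: "nat \<Rightarrow> 'a set \<Rightarrow> 'a plane set \<Rightarrow> bool" where
  "mutually_orthogoval_affine_planes n X \<P> \<longleftrightarrow>
     (\<forall>P\<in>\<P>. affine_plane_of_order n P \<and> points P = X) \<and> mutually_orthogoval \<P>"

definition plane_isomorphic :: "'a plane \<Rightarrow> 'b plane \<Rightarrow> bool" where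
  "plane_isomorphic P Q \<longleftrightarrow>
     (\<exists>f. bij_betw f (points P) (points Q) \<and> (\<lambda>l. f ` l) ` lines P = lines Q)"

definition AG2 :: "('k, 'm) ring_scheme \<Rightarrow> ('k \<times> 'k) plane" where
  "AG2 K =
     \<lparr>points = carrier K \<times> carrier K,
      lines =
        {{(x, y). x \<in> carrier K \<and> y \<in> carrier K \<and>
                  a \<otimes>\<^bsub>K\<^esub> x \<oplus>\<^bsub>K\<^esub> b \<otimes>\<^bsub>K\<^esub> y \<oplus>\<^bsub>K\<^esub> c = \<zero>\<^bsub>K\<^esub>} | a b c.
          a \<in> carrier K \<and> b \<in> carrier K \<and> c \<in> carrier K \<and> (a, b) \<noteq> (\<zero>\<^bsub>K\<^esub>, \<zero>\<^bsub>K\<^esub>)}\<rparr>"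

text \<open>A finite field is determined up to isomorphism by its order \<open>q\<close>, and it has
  a copy whose carrier is a set of natural numbers; hence quantifying over rings on
  \<^typ>\<open>nat\<close> loses no generality.\<close>

definition isomorphic_to_AG2 :: "nat \<Rightarrow> 'a plane \<Rightarrow> bool" where
  "isomorphic_to_AG2 q P \<longleftrightarrow>
     (\<exists>K :: nat ring. field K \<and> finite (carrier K) \<and> card (carrier K) = q \<and>
        plane_isomorphic P (AG2 K))"

end

theory Submission
  imports Defs "HOL-Library.Product_Plus" "HOL-Library.Countable" "HOL-Library.Z2"
begin

text \<open>Upper bound: fix two points. The lines joining them in the various planes of order
  \<open>n\<close> share no third point, and each has \<open>n - 2\<close> of the \<open>n\<^sup>2 - 2\<close> remaining points; for \<open>n = 4\<close>
  this leaves room for at most \<open>14 / 2 = 7\<close> planes.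

  Existence: let the cyclic group \<open>GF(8)\<^sup>*\<close> of order 7 act additively on \<open>K\<^sup>2\<close>, for \<open>K = GF(4)\<close>
  or \<open>K = GF(8)\<close>, and take the seven images of \<open>AG(2, K)\<close>. By translation and the group action,
  two of them fail to be orthogoval only if some \<open>t \<noteq> 1\<close> in the group maps two vectors \<open>u \<noteq> 0\<close>
  and \<open>c u\<close> with \<open>c \<in> K - {0, 1}\<close> to proportional ones. For suitable actions this never happens,
  which is a finite check.\<close>

subsection \<open>The upper bound\<close>

lemma affine_plane_line_subset:
  "\<lbrakk>affine_plane P; l \<in> lines P\<rbrakk> \<Longrightarrow> l \<subseteq> points P"
  by (simp add: affine_plane_def linear_space_def)

lemma affine_plane_ex1_line:
  "\<lbrakk>affine_plane P; x \<in> points P; y \<in> points P; x \<noteq> y\<rbrakk> \<Longrightarrow> \<exists>!l. l \<in> lines P \<and> x \<in> l \<and> y \<in> l"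
  by (simp add: affine_plane_def linear_space_def)

lemma affine_plane_ex1_parallel:
  "\<lbrakk>affine_plane P; l \<in> lines P; x \<in> points P; x \<notin> l\<rbrakk> \<Longrightarrow> \<exists>!m. m \<in> lines P \<and> x \<in> m \<and> m \<inter> l = {}"
  by (simp add: affine_plane_def)

lemma affine_plane_obtain_triangle:
  assumes "affine_plane P"
  obtains x y z where "x \<in> points P" "y \<in> points P" "z \<in> points P" "x \<noteq> y"
    "\<not> (\<exists>l\<in>lines P. {x, y, z} \<subseteq> l)"
proof -
  have "\<exists>x\<in>points P. \<exists>y\<in>points P. \<exists>z\<in>points P.
      x \<noteq> y \<and> x \<noteq> z \<and> y \<noteq> z \<and> \<not> (\<exists>l\<in>lines P. {x, y, z} \<subseteq> l)"
    using assms unfolding affine_plane_def by (elim conjE)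
  then show ?thesis
    by (elim bexE conjE) (rule that)
qed

text \<open>Choose a point \<open>z\<close> off a line \<open>l\<close>. A line through
  \<open>z\<close> is either the parallel \<open>m\<close> to \<open>l\<close> or one of the
  \<open>n\<close> joins of \<open>z\<close> with a point of \<open>l\<close>. These lines cover the
  plane, and counting \<open>z\<close> with \<open>m\<close> only leaves at most
  \<open>n + n * (n - 1)\<close> points.\<close>

lemma affine_plane_card_points:
  assumes "affine_plane_of_order n P"
  shows "finite (points P)" and "card (points P) \<le> n\<^sup>2"
proof -
  have n: "n \<ge> 2" and card: "\<And>l. l \<in> lines P \<Longrightarrow> card l = n" and affine: "affine_plane P"
    using assms by (simp_all add: affine_plane_of_order_def)
  have finite: "finite l" if "l \<in> lines P" for l
    using card[OF that] n by (intro card_ge_0_finite) simp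
  note sub = affine_plane_line_subset[OF affine]
  note join = affine_plane_ex1_line[OF affine]
  obtain x y z where xyz: "x \<in> points P" "y \<in> points P" "z \<in> points P" "x \<noteq> y"
    "\<not> (\<exists>l\<in>lines P. {x, y, z} \<subseteq> l)"
    using affine by (rule affine_plane_obtain_triangle)
  obtain l where l: "l \<in> lines P" "x \<in> l" "y \<in> l"
    using join[OF xyz(1,2,4)] by blast
  have "z \<notin> l"
    using xyz(5) l by blast
  then have "\<exists>!m. m \<in> lines P \<and> z \<in> m \<and> m \<inter> l = {}"
    by (rule affine_plane_ex1_parallel[OF affine l(1) xyz(3)])
  then obtain m where m: "m \<in> lines P" "z \<in> m"
    and parallel: "\<And>k. k \<in> lines P \<Longrightarrow> z \<in> k \<Longrightarrow> k \<inter> l = {} \<Longrightarrow> k = m"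
    by (elim ex1E conjE) metis
  have "\<forall>p\<in>l. \<exists>k. k \<in> lines P \<and> z \<in> k \<and> p \<in> k"
    using join[OF xyz(3)] sub[OF l(1)] \<open>z \<notin> l\<close> by (metis subsetD)
  then obtain L where L: "\<And>p. p \<in> l \<Longrightarrow> L p \<in> lines P \<and> z \<in> L p \<and> p \<in> L p"
    by (auto dest!: bchoice)
  have cover: "points P \<subseteq> m \<union> (\<Union>p\<in>l. L p - {z})"
  proof
    fix q assume q: "q \<in> points P"
    show "q \<in> m \<union> (\<Union>p\<in>l. L p - {z})"
    proof (cases "q = z")
      case False
      then obtain k where k: "k \<in> lines P" "z \<in> k" "q \<in> k"
        using join[OF xyz(3) q] by blast
      show ?thesis
      proof (cases "k \<inter> l = {}")
        case True
        with parallel k show ?thesis by blast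
      next
        case False
        then obtain p where p: "p \<in> k" "p \<in> l" by blast
        with \<open>z \<notin> l\<close> sub[OF l(1)] have "p \<noteq> z" "p \<in> points P" by auto
        with join[OF xyz(3), of p] k p L[OF p(2)] have "k = L p"
          by metis
        with k p \<open>q \<noteq> z\<close> show ?thesis by blast
      qed
    qed (use m in simp)
  qed
  have finite_cover: "finite (m \<union> (\<Union>p\<in>l. L p - {z}))"
    using finite m l L by simp
  then show "finite (points P)"
    using cover by (rule finite_subset[rotated])
  have "card (points P) \<le> card (m \<union> (\<Union>p\<in>l. L p - {z}))"
    using finite_cover cover by (rule card_mono)
  also have "\<dots> \<le> card m + card (\<Union>p\<in>l. L p - {z})"
    by (rule card_Un_le)
  also have "card (\<Union>p\<in>l. L p - {z}) \<le> (\<Sum>p\<in>l. card (L p - {z}))"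
    using finite[OF l(1)] by (rule card_UN_le)
  also have "(\<Sum>p\<in>l. card (L p - {z})) = n * (n - 1)"
    using L card l(1) by simp
  also have "card m + n * (n - 1) = n\<^sup>2"
    using n card[OF m(1)] by (cases n) (simp_all add: power2_eq_square)
  finally show "card (points P) \<le> n\<^sup>2" by simp
qed

lemma mutually_orthogoval_affine_planes_bound:
  assumes \<P>: "mutually_orthogoval_affine_planes n X \<P>" and n: "n > 2"
  shows "finite \<P>" and "card \<P> * (n - 2) \<le> n\<^sup>2 - 2"
proof -
  have "finite \<P> \<and> card \<P> * (n - 2) \<le> n\<^sup>2 - 2"
  proof (cases "\<P> = {}")
    case False
    have plane: "affine_plane_of_order n P" and points: "points P = X" if "P \<in> \<P>" for P
      using \<P> that by (simp_all add: mutually_orthogoval_affine_planes_def)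
    from False obtain P0 where P0: "P0 \<in> \<P>" by blast
    then obtain x y where xy: "x \<in> X" "y \<in> X" "x \<noteq> y"
      using plane[OF P0] points[OF P0]
      by (metis affine_plane_of_order_def affine_plane_obtain_triangle)
    have X: "finite X" "card X \<le> n\<^sup>2"
      using affine_plane_card_points[OF plane[OF P0]] points[OF P0] by simp_all
    have "\<exists>l. l \<in> lines P \<and> x \<in> l \<and> y \<in> l" if "P \<in> \<P>" for P
      using affine_plane_ex1_line[of P x y] plane[OF that] points[OF that] xy
      by (auto simp: affine_plane_of_order_def)
    then obtain L where L: "\<And>P. P \<in> \<P> \<Longrightarrow> L P \<in> lines P \<and> x \<in> L P \<and> y \<in> L P"
      by metis
    have sub: "L P \<subseteq> X" if "P \<in> \<P>" for P
      using affine_plane_line_subset[of P "L P"] plane[OF that] points[OF that] L[OF that]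
      by (simp add: affine_plane_of_order_def)
    have card: "card (L P - {x, y}) = n - 2" if "P \<in> \<P>" for P
    proof -
      have "card (L P) = n"
        using plane[OF that] L[OF that] unfolding affine_plane_of_order_def by blast
      with L[OF that] xy(3) show ?thesis
        by (simp add: card_Diff_subset)
    qed
    have disjoint: "(L P - {x, y}) \<inter> (L Q - {x, y}) = {}" if "P \<in> \<P>" "Q \<in> \<P>" "P \<noteq> Q" for P Q
    proof (rule ccontr)
      assume "(L P - {x, y}) \<inter> (L Q - {x, y}) \<noteq> {}"
      then obtain w where w: "w \<in> L P" "w \<in> L Q" "w \<noteq> x" "w \<noteq> y" by blast
      have "orthogoval P Q"
        using \<P> that unfolding mutually_orthogoval_affine_planes_def mutually_orthogoval_def pairwise_def
        by blast
      then have "card (L P \<inter> L Q) \<le> 2"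
        using L that unfolding orthogoval_def by blast
      moreover have "card {x, y, w} \<le> card (L P \<inter> L Q)"
        using w L that sub[OF that(1)] X(1) by (intro card_mono) (auto intro: finite_subset)
      ultimately show False
        using xy w by simp
    qed
    \<comment> \<open>Since \<open>n > 2\<close>, these sets are nonempty, so disjointness makes
      them differ for different planes. Being subsets of the finite set \<open>X\<close>, they force
      \<open>\<P>\<close> to be finite, as the disjoint union count below requires.\<close>
    have "inj_on (\<lambda>P. L P - {x, y}) \<P>"
    proof (rule inj_onI, rule ccontr)
      fix P Q assume PQ: "P \<in> \<P>" "Q \<in> \<P>" "L P - {x, y} = L Q - {x, y}" "P \<noteq> Q"
      with disjoint have "L P - {x, y} = {}" by blast
      with card[OF PQ(1)] n show False by simp
    qed
    moreover have "(\<lambda>P. L P - {x, y}) ` \<P> \<subseteq> Pow X"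
      using sub by blast
    ultimately have finite: "finite \<P>"
      using X(1) by (meson finite_Pow_iff finite_imageD finite_subset)
    have "card (\<Union>P\<in>\<P>. L P - {x, y}) = (\<Sum>P\<in>\<P>. card (L P - {x, y}))"
    proof (rule card_UN_disjoint)
      show "\<forall>P\<in>\<P>. finite (L P - {x, y})"
        using sub rev_finite_subset[OF X(1)] by blast
    qed (use finite disjoint in blast)+
    then have "card \<P> * (n - 2) = card (\<Union>P\<in>\<P>. L P - {x, y})"
      using card by simp
    also have "\<dots> \<le> card (X - {x, y})"
      using sub X(1) by (intro card_mono) auto
    also have "\<dots> = card X - 2"
      using xy by (simp add: card_Diff_subset)
    finally show ?thesis
      using finite X(2) by simp
  qed simp
  then show "finite \<P>" and "card \<P> * (n - 2) \<le> n\<^sup>2 - 2" by simp_all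
qed

subsection \<open>Coordinate planes\<close>

text \<open>Vanishing expresses linear dependence without division or quantifiers, so that it can be
  evaluated for concrete vectors.\<close>

definition det2 :: "'k::field \<times> 'k \<Rightarrow> 'k \<times> 'k \<Rightarrow> 'k" where
  "det2 u v = fst u * snd v - snd u * fst v"

definition scale2 :: "'k::field \<Rightarrow> 'k \<times> 'k \<Rightarrow> 'k \<times> 'k" where
  "scale2 c u = (c * fst u, c * snd u)"

text \<open>A base point and a direction are used because additive maps are compatible with
  differences of points; \<open>lines_coord_plane_equation\<close> recovers the equations of
  \<open>AG2\<close>.\<close>

definition coord_line :: "'k::field \<times> 'k \<Rightarrow> 'k \<times> 'k \<Rightarrow> ('k \<times> 'k) set" where
  "coord_line p d = {q. det2 d (q - p) = 0}"

definition coord_plane :: "('k::field \<times> 'k) plane" where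
  "coord_plane = \<lparr>points = UNIV, lines = {coord_line p d | p d. d \<noteq> 0}\<rparr>"

text \<open>All planes of the final families are images of the one plane \<open>coord_plane\<close>
  under injections with a common range.\<close>

definition map_plane :: "('a \<Rightarrow> 'b) \<Rightarrow> 'a plane \<Rightarrow> 'b plane" where
  "map_plane f P = \<lparr>points = f ` points P, lines = (`) f ` lines P\<rparr>"

lemma points_map_plane [simp]: "points (map_plane f P) = f ` points P"
  and lines_map_plane [simp]: "lines (map_plane f P) = (`) f ` lines P"
  by (simp_all add: map_plane_def)

lemma points_coord_plane [simp]: "points coord_plane = UNIV"
  and lines_coord_plane: "lines coord_plane = {coord_line p d | p d. d \<noteq> 0}"
  by (simp_all add: coord_plane_def)

lemma coord_line_in_lines: "d \<noteq> 0 \<Longrightarrow> coord_line p d \<in> lines coord_plane"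
  unfolding lines_coord_plane by blast

lemma det2_zero_iff:
  assumes "u \<noteq> 0"
  shows "det2 u v = 0 \<longleftrightarrow> (\<exists>c. v = scale2 c u)"
proof
  assume *: "det2 u v = 0"
  show "\<exists>c. v = scale2 c u"
  proof (cases "fst u = 0")
    case True
    with assms have "snd u \<noteq> 0" by (auto simp: prod_eq_iff)
    with True * have "v = scale2 (snd v / snd u) u"
      by (auto simp: det2_def scale2_def prod_eq_iff)
    then show ?thesis ..
  next
    case False
    with * have "v = scale2 (fst v / fst u) u"
      by (auto simp: det2_def scale2_def prod_eq_iff field_simps)
    then show ?thesis ..
  qed
qed (auto simp: det2_def scale2_def)

lemma det2_eq_0_trans:
  assumes "d \<noteq> 0" "det2 d u = 0" "det2 d v = 0"
  shows "det2 u v = 0"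
  using assms by (auto simp: det2_zero_iff) (simp add: det2_def scale2_def algebra_simps)

lemma det2_commute_0: "det2 u v = 0 \<longleftrightarrow> det2 v u = 0"
  by (auto simp: det2_def algebra_simps)

lemma det2_diff: "det2 d (u - v) = det2 d u - det2 d v"
  by (simp add: det2_def algebra_simps)

lemma det2_self: "det2 u u = 0"
  by (simp add: det2_def)

text \<open>Both uniqueness axioms, for joining lines and for parallels, come down to this change of
  base point and direction. Dependence on \<open>d\<close> and dependence on \<open>e\<close> are
  the same condition by \<open>det2_eq_0_trans\<close>.\<close>

lemma coord_line_eqI:
  assumes "d \<noteq> 0" "e \<noteq> 0" "det2 d e = 0" "q \<in> coord_line p d"
  shows "coord_line p d = coord_line q e"
proof -
  have "det2 d v = 0 \<longleftrightarrow> det2 e v = 0" for v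
    using assms det2_eq_0_trans[of d e v] det2_eq_0_trans[of e d v] det2_commute_0 by blast
  moreover have "det2 d (r - p) = det2 d (r - q)" for r
    using assms(4) by (simp add: coord_line_def det2_diff)
  ultimately show ?thesis
    by (simp add: coord_line_def)
qed

lemma mem_coord_line_self: "p \<in> coord_line p d"
  by (simp add: coord_line_def det2_def)

lemma card_coord_line:
  fixes d :: "'k :: {field, finite} \<times> 'k"
  assumes "d \<noteq> 0"
  shows "card (coord_line p d) = card (UNIV :: 'k set)"
proof -
  have "bij_betw (\<lambda>c. p + scale2 c d) UNIV (coord_line p d)"
  proof (rule bij_betw_imageI)
    show "inj (\<lambda>c. p + scale2 c d)"
      using assms by (auto simp: inj_on_def scale2_def prod_eq_iff)
    show "range (\<lambda>c. p + scale2 c d) = coord_line p d"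
      using assms by (auto simp: coord_line_def det2_zero_iff image_iff algebra_simps)
  qed
  then show ?thesis
    by (simp add: bij_betw_same_card)
qed

section \<open>The axioms of an affine plane in coordinates\<close>

lemma linear_space_coord_plane: "linear_space (coord_plane :: ('k::field \<times> 'k) plane)"
  unfolding linear_space_def
proof (intro conjI ballI impI)
  fix x y :: "'k \<times> 'k"
  assume "x \<noteq> y"
  show "\<exists>!l. l \<in> lines coord_plane \<and> x \<in> l \<and> y \<in> l"
  proof (rule ex1I)
    show "coord_line x (y - x) \<in> lines coord_plane \<and> x \<in> coord_line x (y - x) \<and> y \<in> coord_line x (y - x)"
      using \<open>x \<noteq> y\<close> by (simp add: coord_line_in_lines mem_coord_line_self)
        (simp add: coord_line_def det2_self)
  next
    fix l assume l: "l \<in> lines coord_plane \<and> x \<in> l \<and> y \<in> l"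
    then obtain p d where pd: "l = coord_line p d" "d \<noteq> 0"
      by (auto simp: lines_coord_plane)
    have "det2 d (y - x) = 0"
      using l by (auto simp: pd coord_line_def det2_diff)
    with l pd \<open>x \<noteq> y\<close> show "l = coord_line x (y - x)"
      using coord_line_eqI[of d "y - x" x p] by auto
  qed
qed auto

lemma coord_lines_meet:
  assumes "det2 d e \<noteq> 0"
  shows "coord_line p d \<inter> coord_line q e \<noteq> {}"
proof -
  \<comment> \<open>Cramer's rule: with this factor the point \<open>q + scale2 c e\<close> of the
    second line satisfies the equation of the first.\<close>
  define c where "c = det2 d (p - q) / det2 d e"
  have "q + scale2 c e \<in> coord_line q e"
    by (simp add: coord_line_def det2_def scale2_def)
  moreover have "det2 d (q + scale2 c e - p) = c * det2 d e - det2 d (p - q)"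
    by (simp add: det2_def scale2_def algebra_simps)
  then have "q + scale2 c e \<in> coord_line p d"
    using assms by (simp add: coord_line_def c_def)
  ultimately show ?thesis by blast
qed

lemma affine_plane_coord_plane: "affine_plane (coord_plane :: ('k::field \<times> 'k) plane)"
  unfolding affine_plane_def
proof (intro conjI ballI impI)
  show "linear_space (coord_plane :: ('k \<times> 'k) plane)"
    by (rule linear_space_coord_plane)
next
  fix l :: "('k \<times> 'k) set" and x
  assume "l \<in> lines coord_plane" and "x \<notin> l"
  then obtain p d where l: "l = coord_line p d" "d \<noteq> 0"
    by (auto simp: lines_coord_plane)
  show "\<exists>!m. m \<in> lines coord_plane \<and> x \<in> m \<and> m \<inter> l = {}"
  proof (rule ex1I)
    have "coord_line x d \<inter> l = {}"
      using \<open>x \<notin> l\<close> by (auto simp: l coord_line_def det2_diff)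
    then show "coord_line x d \<in> lines coord_plane \<and> x \<in> coord_line x d \<and> coord_line x d \<inter> l = {}"
      using l mem_coord_line_self coord_line_in_lines by blast
  next
    fix m assume m: "m \<in> lines coord_plane \<and> x \<in> m \<and> m \<inter> l = {}"
    then obtain q e where e: "m = coord_line q e" "e \<noteq> 0"
      by (auto simp: lines_coord_plane)
    with m l have "det2 e d = 0"
      using coord_lines_meet by blast
    with e l m show "m = coord_line x d"
      using coord_line_eqI by blast
  qed
next
  have "\<not> {0, (1, 0), (0, 1)} \<subseteq> l" if "l \<in> lines coord_plane" for l :: "('k \<times> 'k) set"
    using that by (auto simp: lines_coord_plane coord_line_def det2_def prod_eq_iff algebra_simps)
  then show "\<exists>x\<in>points coord_plane. \<exists>y\<in>points coord_plane. \<exists>z\<in>points coord_plane.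
      x \<noteq> y \<and> x \<noteq> z \<and> y \<noteq> z \<and> \<not> (\<exists>l\<in>lines coord_plane. {x, y, z :: 'k \<times> 'k} \<subseteq> l)"
    by (intro bexI[of _ 0] bexI[of _ "(1, 0)"] bexI[of _ "(0, 1)"]) (auto simp: prod_eq_iff)
qed

lemma affine_plane_of_order_coord_plane:
  "affine_plane_of_order (card (UNIV :: 'k set)) (coord_plane :: ('k::{field, finite} \<times> 'k) plane)"
proof -
  have "card {0, 1 :: 'k} \<le> card (UNIV :: 'k set)"
    by (rule card_mono) auto
  then show ?thesis
    by (auto simp: affine_plane_of_order_def affine_plane_coord_plane card_coord_line lines_coord_plane)
qed

text \<open>An injection preserves and reflects membership, inclusion, disjointness and cardinality,
  so each axiom for the image rewrites to the same axiom for \<open>P\<close>. Unique existence of a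
  line is treated by \<open>ex1_image\<close>, since taking images of lines is injective
  too.\<close>

lemma affine_plane_of_order_map_plane:
  assumes f: "inj f" and P: "affine_plane_of_order n P"
  shows "affine_plane_of_order n (map_plane f P)"
proof -
  have ex1_image: "(\<exists>!l. l \<in> (`) f ` L \<and> Q l) \<longleftrightarrow> (\<exists>!l. l \<in> L \<and> Q (f ` l))" for L Q
  proof
    assume "\<exists>!l. l \<in> (`) f ` L \<and> Q l"
    then obtain l' where l': "l' \<in> (`) f ` L" "Q l'"
      and unique: "\<And>m. m \<in> (`) f ` L \<and> Q m \<Longrightarrow> m = l'"
      by (elim ex1E conjE) metis
    from l'(1) obtain l where l: "l' = f ` l" "l \<in> L"
      by (rule imageE)
    show "\<exists>!l. l \<in> L \<and> Q (f ` l)"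
    proof (rule ex1I)
      show "l \<in> L \<and> Q (f ` l)"
        using l l' by simp
      show "m = l" if "m \<in> L \<and> Q (f ` m)" for m
        using unique[of "f ` m"] that by (simp add: l inj_image_eq_iff[OF f])
    qed
  next
    assume "\<exists>!l. l \<in> L \<and> Q (f ` l)"
    then obtain l where l: "l \<in> L" "Q (f ` l)"
      and unique: "\<And>m. m \<in> L \<and> Q (f ` m) \<Longrightarrow> m = l"
      by (elim ex1E conjE) metis
    show "\<exists>!l. l \<in> (`) f ` L \<and> Q l"
    proof (rule ex1I)
      show "f ` l \<in> (`) f ` L \<and> Q (f ` l)"
        using l by simp
      show "m = f ` l" if m: "m \<in> (`) f ` L \<and> Q m" for m
      proof -
        from m obtain k where "m = f ` k" "k \<in> L"
          by (elim conjE imageE)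
        with m unique show ?thesis by simp
      qed
    qed
  qed
  have disjoint: "f ` l \<inter> f ` m = {} \<longleftrightarrow> l \<inter> m = {}" for l m
    by (simp flip: image_Int[OF f])
  have subset: "f ` l \<subseteq> f ` m \<longleftrightarrow> l \<subseteq> m" for l m
    by (rule inj_image_subset_iff[OF f])
  have card: "card (f ` l) = card l" for l
    using f by (simp add: card_image inj_on_subset)
  show ?thesis
    using P unfolding affine_plane_of_order_def affine_plane_def linear_space_def
      points_map_plane lines_map_plane ball_simps bex_simps ex1_image
      inj_image_mem_iff[OF f] inj_eq[OF f] disjoint card subset insert_subset
    by simp
qed

lemma collinear_coord_line:
  assumes "l \<in> lines coord_plane" "p \<in> l" "q \<in> l" "r \<in> l"
  shows "det2 (q - p) (r - p) = 0"
proof -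
  obtain o' d where l: "l = coord_line o' d" "d \<noteq> 0"
    using assms(1) by (auto simp: lines_coord_plane)
  have "det2 d (q - p) = 0" "det2 d (r - p) = 0"
    using assms by (simp_all add: l coord_line_def det2_diff)
  with l(2) show ?thesis
    by (rule det2_eq_0_trans)
qed

section \<open>Finite fields as rings on natural numbers, and AG(2, q)\<close>

definition nat_ring :: "'k::{field, countable} itself \<Rightarrow> nat ring" where
  "nat_ring _ = \<lparr>carrier = range (to_nat :: 'k \<Rightarrow> nat),
     mult = \<lambda>m n. to_nat (from_nat m * from_nat n :: 'k), one = to_nat (1 :: 'k),
     zero = to_nat (0 :: 'k), add = \<lambda>m n. to_nat (from_nat m + from_nat n :: 'k)\<rparr>"

text \<open>The laws of the type class are transported along the coding \<open>to_nat\<close>. This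
  links fields given as types with the rings on \<open>nat\<close> that
  \<open>isomorphic_to_AG2\<close> asks for.\<close>

lemma field_nat_ring: "field (nat_ring TYPE('k::{field, countable}))"
proof (rule cring.cring_fieldI2)
  show "cring (nat_ring TYPE('k))"
  proof (rule cringI)
    show "abelian_group (nat_ring TYPE('k))"
    proof (rule abelian_groupI)
      fix x assume "x \<in> carrier (nat_ring TYPE('k))"
      then obtain a :: 'k where "x = to_nat a"
        by (auto simp: nat_ring_def)
      then show "\<exists>y\<in>carrier (nat_ring TYPE('k)). y \<oplus>\<^bsub>nat_ring TYPE('k)\<^esub> x = \<zero>\<^bsub>nat_ring TYPE('k)\<^esub>"
        by (intro bexI[of _ "to_nat (- a)"]) (auto simp: nat_ring_def)
    qed (auto simp: nat_ring_def algebra_simps)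
    show "comm_monoid (nat_ring TYPE('k))"
      by (rule comm_monoidI) (auto simp: nat_ring_def algebra_simps)
  qed (auto simp: nat_ring_def algebra_simps)
  show "\<zero>\<^bsub>nat_ring TYPE('k)\<^esub> \<noteq> \<one>\<^bsub>nat_ring TYPE('k)\<^esub>"
    by (simp add: nat_ring_def)
  fix x assume "x \<in> carrier (nat_ring TYPE('k))" "x \<noteq> \<zero>\<^bsub>nat_ring TYPE('k)\<^esub>"
  then obtain a :: 'k where "x = to_nat a" "a \<noteq> 0"
    by (auto simp: nat_ring_def)
  then show "\<exists>y\<in>carrier (nat_ring TYPE('k)). x \<otimes>\<^bsub>nat_ring TYPE('k)\<^esub> y = \<one>\<^bsub>nat_ring TYPE('k)\<^esub>"
    by (intro bexI[of _ "to_nat (inverse a)"]) (auto simp: nat_ring_def)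
qed

lemma lines_coord_plane_equation:
  "lines (coord_plane :: ('k::field \<times> 'k) plane) = {{(x, y). a * x + b * y + c = 0} | a b c. (a, b) \<noteq> (0, 0)}"
proof (intro equalityI subsetI)
  fix l :: "('k \<times> 'k) set"
  assume "l \<in> lines coord_plane"
  then obtain p d where "l = coord_line p d" "d \<noteq> 0"
    by (auto simp: lines_coord_plane)
  then have "l = {(x, y). (- snd d) * x + fst d * y + (snd d * fst p - fst d * snd p) = 0}"
    and "(- snd d, fst d) \<noteq> (0, 0)"
    by (auto simp: coord_line_def det2_def algebra_simps prod_eq_iff)
  then show "l \<in> {{(x, y). a * x + b * y + c = 0} | a b c. (a, b) \<noteq> (0, 0)}"
    by blast
next
  fix l :: "('k \<times> 'k) set"
  assume "l \<in> {{(x, y). a * x + b * y + c = 0} | a b c. (a, b) \<noteq> (0, 0)}"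
  then obtain a b c where l: "l = {(x, y). a * x + b * y + c = 0}" "(a, b) \<noteq> (0, 0)"
    by blast
  \<comment> \<open>A base point of the line is its intersection with the second coordinate axis if
    \<open>a = 0\<close>, and with the first otherwise. The direction is then
    \<open>(b, - a)\<close>.\<close>
  obtain x y where xy: "a * x + b * y + c = 0"
  proof (cases "a = 0")
    case True
    with l that[of 0 "- c / b"] show ?thesis by simp
  next
    case False
    with that[of "- c / a" 0] show ?thesis by simp
  qed
  have c: "c = - (a * x + b * y)"
    using minus_unique[OF xy] by simp
  have "l = coord_line (x, y) (b, - a)"
    unfolding l c by (auto simp: coord_line_def det2_def algebra_simps)
  moreover have "(b, - a) \<noteq> 0"
    using l by (auto simp: zero_prod_def)
  ultimately show "l \<in> lines coord_plane"
    by (simp add: coord_line_in_lines)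
qed

text \<open>Coding both coordinates turns an equation over \<open>'k\<close> into the equation with
  coded coefficients over the ring of codes. Hence this is an equality of planes and not just an
  isomorphism.\<close>

lemma AG2_nat_ring:
  "AG2 (nat_ring TYPE('k::{field, countable})) =
     map_plane (map_prod to_nat to_nat) (coord_plane :: ('k \<times> 'k) plane)"
proof -
  let ?K = "nat_ring TYPE('k)"
  define line :: "'k \<Rightarrow> 'k \<Rightarrow> 'k \<Rightarrow> ('k \<times> 'k) set" where
    "line a b c = {(x, y). a * x + b * y + c = 0}" for a b c
  define nline where
    "nline a b c = {(x, y). x \<in> carrier ?K \<and> y \<in> carrier ?K \<and>
       a \<otimes>\<^bsub>?K\<^esub> x \<oplus>\<^bsub>?K\<^esub> b \<otimes>\<^bsub>?K\<^esub> y \<oplus>\<^bsub>?K\<^esub> c = \<zero>\<^bsub>?K\<^esub>}" for a b c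
  have nline: "nline (to_nat a) (to_nat b) (to_nat c) = map_prod to_nat to_nat ` line a b c" for a b c :: 'k
    by (auto simp: nline_def line_def nat_ring_def)
  have "lines (AG2 ?K) = {nline a b c | a b c. a \<in> carrier ?K \<and> b \<in> carrier ?K \<and> c \<in> carrier ?K \<and>
      (a, b) \<noteq> (\<zero>\<^bsub>?K\<^esub>, \<zero>\<^bsub>?K\<^esub>)}"
    by (simp add: AG2_def nline_def)
  also have "\<dots> = {nline (to_nat a) (to_nat b) (to_nat c) | (a :: 'k) (b :: 'k) (c :: 'k). (a, b) \<noteq> (0, 0)}"
  proof (intro equalityI subsetI)
    fix l assume "l \<in> {nline a b c | a b c. a \<in> carrier ?K \<and> b \<in> carrier ?K \<and> c \<in> carrier ?K \<and>
      (a, b) \<noteq> (\<zero>\<^bsub>?K\<^esub>, \<zero>\<^bsub>?K\<^esub>)}"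
    then obtain a b c :: 'k where "l = nline (to_nat a) (to_nat b) (to_nat c)" "(a, b) \<noteq> (0, 0)"
      by (auto simp: nat_ring_def)
    then show "l \<in> {nline (to_nat a) (to_nat b) (to_nat c) | (a :: 'k) (b :: 'k) (c :: 'k). (a, b) \<noteq> (0, 0)}"
      by blast
  next
    fix l assume "l \<in> {nline (to_nat a) (to_nat b) (to_nat c) | (a :: 'k) (b :: 'k) (c :: 'k). (a, b) \<noteq> (0, 0)}"
    then obtain a b c :: 'k where "l = nline (to_nat a) (to_nat b) (to_nat c)" "(a, b) \<noteq> (0, 0)"
      by blast
    moreover from this have "(to_nat a, to_nat b) \<noteq> (\<zero>\<^bsub>?K\<^esub>, \<zero>\<^bsub>?K\<^esub>)"
      and "to_nat a \<in> carrier ?K" "to_nat b \<in> carrier ?K" "to_nat c \<in> carrier ?K"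
      by (auto simp: nat_ring_def)
    ultimately show "l \<in> {nline a b c | a b c. a \<in> carrier ?K \<and> b \<in> carrier ?K \<and> c \<in> carrier ?K \<and>
      (a, b) \<noteq> (\<zero>\<^bsub>?K\<^esub>, \<zero>\<^bsub>?K\<^esub>)}"
      by blast
  qed
  also have "\<dots> = (`) (map_prod to_nat to_nat) ` {line a b c | a b c. (a, b) \<noteq> (0, 0)}"
    by (auto simp: nline)
  finally have "lines (AG2 ?K) = lines (map_plane (map_prod to_nat to_nat) (coord_plane :: ('k \<times> 'k) plane))"
    by (simp add: lines_coord_plane_equation line_def)
  moreover have "points (AG2 ?K) = points (map_plane (map_prod to_nat to_nat) (coord_plane :: ('k \<times> 'k) plane))"
    by (auto simp: AG2_def nat_ring_def)
  ultimately show ?thesis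
    by (metis plane.surjective unit.exhaust)
qed

text \<open>The isomorphism undoes \<open>f\<close> and then codes both coordinates, which leads to
  the plane of \<open>AG2_nat_ring\<close>.\<close>

lemma isomorphic_map_coord_plane:
  fixes f :: "'k::{field, finite} \<times> 'k \<Rightarrow> 'a"
  assumes "inj f"
  shows "isomorphic_to_AG2 (card (UNIV :: 'k set)) (map_plane f coord_plane)"
  unfolding isomorphic_to_AG2_def
proof (intro exI conjI)
  let ?K = "nat_ring TYPE('k)"
  let ?g = "map_prod to_nat to_nat :: 'k \<times> 'k \<Rightarrow> nat \<times> nat"
  show "field ?K"
    by (rule field_nat_ring)
  show "finite (carrier ?K)" "card (carrier ?K) = card (UNIV :: 'k set)"
    by (simp_all add: nat_ring_def card_image)
  have "inj ?g"
    by (simp add: prod.inj_map)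
  then have "bij_betw (?g \<circ> inv_into UNIV f) (range f) (range ?g)"
    using assms by (intro bij_betw_trans[of _ _ UNIV])
      (auto simp: bij_betw_inv_into inj_imp_bij_betw_inv inj_on_imp_bij_betw)
  moreover have "(\<lambda>l. (?g \<circ> inv_into UNIV f) ` l) ` (`) f ` L = (`) ?g ` L" for L
    using assms by (simp add: image_image image_comp)
  ultimately show "plane_isomorphic (map_plane f coord_plane) (AG2 ?K)"
    unfolding AG2_nat_ring plane_isomorphic_def by (intro exI[of _ "?g \<circ> inv_into UNIV f"]) simp
qed

section \<open>A criterion for orthogovality and its application to orbits\<close>

lemma orthogoval_map_planesI:
  fixes f g :: "'k::{field, finite} \<times> 'k \<Rightarrow> 'a"
  assumes inj: "inj f" "inj g" and range: "range f = range g"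
    and no_common_triangle: "\<And>p q r p' q' r'. \<lbrakk>f p = g p'; f q = g q'; f r = g r';
      p \<noteq> q; p \<noteq> r; q \<noteq> r; det2 (q - p) (r - p) = 0\<rbrakk> \<Longrightarrow> det2 (q' - p') (r' - p') \<noteq> 0"
  shows "orthogoval (map_plane f coord_plane) (map_plane g coord_plane)"
  unfolding orthogoval_def
proof (intro conjI exI disjI1 ballI)
  show "affine_plane_of_order (card (UNIV :: 'k set)) (map_plane f coord_plane)"
    "affine_plane_of_order (card (UNIV :: 'k set)) (map_plane g coord_plane)"
    by (rule affine_plane_of_order_map_plane[OF inj(1) affine_plane_of_order_coord_plane])
      (rule affine_plane_of_order_map_plane[OF inj(2) affine_plane_of_order_coord_plane])
  fix l' m' assume "l' \<in> lines (map_plane f coord_plane)" "m' \<in> lines (map_plane g coord_plane)"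
  then obtain l m where lm: "l' = f ` l" "m' = g ` m" "l \<in> lines coord_plane" "m \<in> lines coord_plane"
    by auto
  show "card (l' \<inter> m') \<le> 2"
  proof (rule ccontr)
    \<comment> \<open>Three common points of the two lines pull back along \<open>f\<close> and
      along \<open>g\<close> to collinear triples, contradicting
      \<open>no_common_triangle\<close>.\<close>
    assume "\<not> card (l' \<inter> m') \<le> 2"
    then have "3 \<le> card (l' \<inter> m')"
      by simp
    then obtain T where T: "T \<subseteq> l' \<inter> m'" "card T = 3"
      by (rule obtain_subset_with_card_n)
    from T(2) obtain x y z where "T = {x, y, z}" and xyz: "x \<noteq> y" "x \<noteq> z" "y \<noteq> z"
      unfolding card_3_iff by blast
    with T(1) have "x \<in> f ` l" "y \<in> f ` l" "z \<in> f ` l" "x \<in> g ` m" "y \<in> g ` m" "z \<in> g ` m"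
      by (simp_all add: lm)
    then obtain p q r p' q' r' where l: "x = f p" "y = f q" "z = f r" "p \<in> l" "q \<in> l" "r \<in> l"
      and m: "x = g p'" "y = g q'" "z = g r'" "p' \<in> m" "q' \<in> m" "r' \<in> m"
      by (elim imageE)
    have "det2 (q' - p') (r' - p') \<noteq> 0"
    proof (rule no_common_triangle)
      show "f p = g p'" "f q = g q'" "f r = g r'"
        using l m by simp_all
      show "p \<noteq> q" "p \<noteq> r" "q \<noteq> r"
        using xyz l by auto
      show "det2 (q - p) (r - p) = 0"
        using collinear_coord_line[OF lm(3)] l by blast
    qed
    moreover have "det2 (q' - p') (r' - p') = 0"
      using collinear_coord_line[OF lm(4)] m by blast
    ultimately show False by blast
  qed
qed (use range in simp)

text \<open>A line with more than two points meets itself too often. As \<open>pairwise\<close> says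
  nothing about equal members, this is what separates the planes of an orbit and allows them to be
  counted.\<close>

lemma not_orthogoval_self:
  assumes "affine_plane_of_order n P" "2 < n" "l \<in> lines P"
  shows "\<not> orthogoval P P"
proof
  assume "orthogoval P P"
  with assms(3) have "card (l \<inter> l) \<le> 2"
    unfolding orthogoval_def by blast
  moreover have "card l = n"
    using assms(1,3) unfolding affine_plane_of_order_def by blast
  ultimately show False
    using assms(2) by simp
qed

text \<open>The field \<open>'i\<close> enters through its multiplicative group, which
  \<open>h\<close> lets act by additive bijections; each nonzero element gives one plane.\<close>

lemma mutually_orthogoval_orbit:
  fixes h :: "'i::{field, finite} \<Rightarrow> 'k::{field, finite} \<times> 'k \<Rightarrow> 'k \<times> 'k"
  assumes card_k: "2 < card (UNIV :: 'k set)"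
    and h_add: "\<And>t u v. h t (u + v) = h t u + h t v"
    and h_mult: "\<And>s t u. h (s * t) u = h s (h t u)"
    and h_one: "\<And>u. h 1 u = u"
    and det: "\<And>t c u. \<lbrakk>t \<noteq> 0; t \<noteq> 1; c \<noteq> 0; c \<noteq> 1; u \<noteq> 0\<rbrakk> \<Longrightarrow>
      det2 (h t u) (h t (scale2 c u)) \<noteq> 0"
  shows "\<exists>(X :: nat set) \<P>. mutually_orthogoval_affine_planes (card (UNIV :: 'k set)) X \<P> \<and>
    (\<forall>P\<in>\<P>. isomorphic_to_AG2 (card (UNIV :: 'k set)) P) \<and> card \<P> = card (UNIV :: 'i set) - 1"
proof -
  \<comment> \<open>The coding by \<open>to_nat\<close> places all planes on one set of natural
    numbers. Being the same for every \<open>s\<close>, it cancels when two planes are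
    compared.\<close>
  define f :: "'i \<Rightarrow> 'k \<times> 'k \<Rightarrow> nat" where "f s u = to_nat (h s u)" for s u
  define plane where "plane s = map_plane (f s) coord_plane" for s
  have cancel: "h (inverse s) (h s u) = u" "h s (h (inverse s) u) = u" if "s \<noteq> 0" for s u
    using that by (simp_all add: h_one flip: h_mult)
  have "bij (h s)" if "s \<noteq> 0" for s
    by (rule o_bij[of "h (inverse s)"]) (simp_all add: fun_eq_iff cancel that)
  then have inj_h: "inj (h s)" and surj_h: "range (h s) = UNIV" if "s \<noteq> 0" for s
    using that by (simp_all add: bij_def)
  have inj: "inj (f s)" if "s \<noteq> 0" for s
    using inj_h[OF that] by (simp add: f_def inj_def)
  have "f s = to_nat \<circ> h s" for s
    by (simp add: fun_eq_iff f_def)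
  then have range: "range (f s) = range (to_nat :: 'k \<times> 'k \<Rightarrow> nat)" if "s \<noteq> 0" for s
    using surj_h[OF that] by (metis image_comp)
  have h_diff: "h t (u - v) = h t u - h t v" for t u v
    using h_add[of t "u - v" v] by (simp add: algebra_simps)
  have orthogoval: "orthogoval (plane s) (plane t)" if st: "s \<noteq> 0" "t \<noteq> 0" "s \<noteq> t" for s t
    unfolding plane_def
  proof (rule orthogoval_map_planesI)
    fix p q r p' q' r' :: "'k \<times> 'k"
    assume eq: "f s p = f t p'" "f s q = f t q'" "f s r = f t r'"
      and distinct: "p \<noteq> q" "p \<noteq> r" "q \<noteq> r" and collinear: "det2 (q - p) (r - p) = 0"
    \<comment> \<open>The coordinates of a point in the plane of \<open>t\<close> are the image
      under \<open>h k\<close> of its coordinates in the plane of \<open>s\<close>, so a single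
      group element \<open>k \<noteq> 1\<close> replaces the pair.\<close>
    define k where "k = inverse t * s"
    have k: "k \<noteq> 0" "k \<noteq> 1"
      using st by (auto simp: k_def field_simps)
    have "h (inverse t) (h t x') = h k x" if "f s x = f t x'" for x x'
      using that by (simp add: f_def k_def h_mult)
    with eq cancel(1)[OF st(2)] have p': "p' = h k p" "q' = h k q" "r' = h k r"
      by metis+
    have "q - p \<noteq> 0"
      using distinct by simp
    then obtain c where c: "r - p = scale2 c (q - p)"
      using collinear det2_zero_iff by blast
    have "c \<noteq> 0" "c \<noteq> 1"
      using c distinct by (auto simp: scale2_def prod_eq_iff)
    then show "det2 (q' - p') (r' - p') \<noteq> 0"
      using det[OF k _ _ \<open>q - p \<noteq> 0\<close>, of c] by (simp add: p' c flip: h_diff)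
  qed (simp_all add: inj range st)
  have affine: "affine_plane_of_order (card (UNIV :: 'k set)) (plane s)" if "s \<noteq> 0" for s
    unfolding plane_def using inj[OF that] affine_plane_of_order_coord_plane
    by (rule affine_plane_of_order_map_plane)
  have distinct: "plane s \<noteq> plane t" if "s \<noteq> 0" "t \<noteq> 0" "s \<noteq> t" for s t
  proof
    assume "plane s = plane t"
    moreover have "f s ` coord_line 0 (1, 0) \<in> lines (plane s)"
      by (simp add: plane_def coord_line_in_lines prod_eq_iff)
    ultimately show False
      using not_orthogoval_self[OF affine[OF that(1)] card_k] orthogoval[OF that] by metis
  qed
  then have "inj_on plane (UNIV - {0})"
    by (auto simp: inj_on_def)
  then have card: "card (plane ` (UNIV - {0})) = card (UNIV :: 'i set) - 1"
    by (simp add: card_image card_Diff_subset)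
  have "mutually_orthogoval_affine_planes (card (UNIV :: 'k set)) (range (to_nat :: 'k \<times> 'k \<Rightarrow> nat))
      (plane ` (UNIV - {0}))"
    unfolding mutually_orthogoval_affine_planes_def mutually_orthogoval_def pairwise_def
    using affine orthogoval by (auto simp: plane_def range)
  moreover have "isomorphic_to_AG2 (card (UNIV :: 'k set)) P" if "P \<in> plane ` (UNIV - {0})" for P
    using that isomorphic_map_coord_plane inj by (auto simp: plane_def)
  ultimately show ?thesis
    using card by blast
qed

subsection \<open>The fields of order 4 and 8\<close>

text \<open>\<open>GF4 a b\<close> stands for \<open>a + b \<omega>\<close> with \<open>\<omega>\<^sup>2 = \<omega> + 1\<close>, and \<open>GF8 a b c\<close> for
  \<open>a + b \<alpha> + c \<alpha>\<^sup>2\<close> with \<open>\<alpha>\<^sup>3 = \<alpha> + 1\<close>.\<close>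

datatype gf4 = GF4 bit bit
datatype gf8 = GF8 bit bit bit

text \<open>Besides finiteness, the enumeration makes quantifiers over the field executable, as the
  determinant checks by \<open>code_simp\<close> require.\<close>

instantiation gf4 :: enum
begin
definition "enum_gf4 = [GF4 a b. a \<leftarrow> [0, 1], b \<leftarrow> [0, 1]]"
definition "enum_all_gf4 P \<longleftrightarrow> list_all P (enum_class.enum :: gf4 list)"
definition "enum_ex_gf4 P \<longleftrightarrow> list_ex P (enum_class.enum :: gf4 list)"
instance
proof
  show UNIV: "(UNIV :: gf4 set) = set enum_class.enum"
  proof (intro UNIV_eq_I)
    fix x :: gf4
    obtain a b where x: "x = GF4 a b" by (cases x)
    show "x \<in> set enum_class.enum"
      unfolding x by (cases a; cases b; simp add: enum_gf4_def)
  qed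
  show "distinct (enum_class.enum :: gf4 list)"
    by (simp add: enum_gf4_def)
  fix P :: "gf4 \<Rightarrow> bool"
  show "enum_class.enum_all P \<longleftrightarrow> Ball UNIV P"
    by (simp only: UNIV enum_all_gf4_def list_all_iff)
  show "enum_class.enum_ex P \<longleftrightarrow> Bex UNIV P"
    by (simp only: UNIV enum_ex_gf4_def list_ex_iff)
qed
end

instantiation gf8 :: enum
begin
definition "enum_gf8 = [GF8 a b c. a \<leftarrow> [0, 1], b \<leftarrow> [0, 1], c \<leftarrow> [0, 1]]"
definition "enum_all_gf8 P \<longleftrightarrow> list_all P (enum_class.enum :: gf8 list)"
definition "enum_ex_gf8 P \<longleftrightarrow> list_ex P (enum_class.enum :: gf8 list)"
instance
proof
  show UNIV: "(UNIV :: gf8 set) = set enum_class.enum"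
  proof (intro UNIV_eq_I)
    fix x :: gf8
    obtain a b c where x: "x = GF8 a b c" by (cases x)
    show "x \<in> set enum_class.enum"
      unfolding x by (cases a; cases b; cases c; simp add: enum_gf8_def)
  qed
  show "distinct (enum_class.enum :: gf8 list)"
    by (simp add: enum_gf8_def)
  fix P :: "gf8 \<Rightarrow> bool"
  show "enum_class.enum_all P \<longleftrightarrow> Ball UNIV P"
    by (simp only: UNIV enum_all_gf8_def list_all_iff)
  show "enum_class.enum_ex P \<longleftrightarrow> Bex UNIV P"
    by (simp only: UNIV enum_ex_gf8_def list_ex_iff)
qed
end

lemma card_gf4: "card (UNIV :: gf4 set) = 4"
  by (simp add: card_UNIV_length_enum enum_gf4_def)

lemma card_gf8: "card (UNIV :: gf8 set) = 8"
  by (simp add: card_UNIV_length_enum enum_gf8_def)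

instantiation gf4 :: field
begin
definition "0 = GF4 0 0"
definition "1 = GF4 1 0"
definition "x + y = (case (x, y) of (GF4 a b, GF4 a' b') \<Rightarrow> GF4 (a + a') (b + b'))"
definition "- (x :: gf4) = x"
definition "x - y = x + (y :: gf4)"
definition "x * y = (case (x, y) of (GF4 a b, GF4 a' b') \<Rightarrow>
   GF4 (a * a' + b * b') (a * b' + b * a' + b * b'))"
text \<open>Nonzero elements satisfy \<open>x^3 = 1\<close>.\<close>

definition "inverse (x :: gf4) = x * x"
definition "x div y = x * inverse (y :: gf4)"
instance
proof
  fix x y z :: gf4
  note defs = zero_gf4_def one_gf4_def plus_gf4_def uminus_gf4_def minus_gf4_def times_gf4_def
    inverse_gf4_def divide_gf4_def
  \<comment> \<open>Associativity, commutativity and distributivity are polynomial identities in the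
    coordinates, valid over every commutative ring. The inverse law is instead checked element by
    element.\<close>
  show "x * y * z = x * (y * z)" by (cases x; cases y; cases z) (simp only: defs prod.case gf4.case gf4.inject algebra_simps simp_thms)
  show "(x + y) * z = x * z + y * z" by (cases x; cases y; cases z) (simp only: defs prod.case gf4.case gf4.inject algebra_simps simp_thms)
  show "x + y + z = x + (y + z)" by (cases x; cases y; cases z) (simp only: defs prod.case gf4.case gf4.inject algebra_simps simp_thms)
  show "x * y = y * x" by (cases x; cases y) (simp only: defs prod.case gf4.case gf4.inject algebra_simps simp_thms)
  show "x + y = y + x" by (cases x; cases y) (simp only: defs prod.case gf4.case gf4.inject algebra_simps simp_thms)
  show "x \<noteq> 0 \<Longrightarrow> inverse x * x = 1"
  proof -
    obtain a b where x: "x = GF4 a b" by (cases x)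
    show "x \<noteq> 0 \<Longrightarrow> inverse x * x = 1"
      unfolding x by (cases a; cases b) (simp_all add: defs)
  qed
qed (auto simp: zero_gf4_def one_gf4_def plus_gf4_def uminus_gf4_def minus_gf4_def times_gf4_def
    inverse_gf4_def divide_gf4_def split: gf4.split)
end

instantiation gf8 :: field
begin
definition "0 = GF8 0 0 0"
definition "1 = GF8 1 0 0"
definition "x + y = (case (x, y) of (GF8 a b c, GF8 a' b' c') \<Rightarrow>
   GF8 (a + a') (b + b') (c + c'))"
definition "- (x :: gf8) = x"
definition "x - y = x + (y :: gf8)"
text \<open>Terms of degree 3 and 4 are reduced by \<open>\<alpha>^3 = \<alpha> + 1\<close> and
  \<open>\<alpha>^4 = \<alpha>^2 + \<alpha>\<close>.\<close>

definition "x * y = (case (x, y) of (GF8 a b c, GF8 a' b' c') \<Rightarrow>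
   GF8 (a * a' + (b * c' + c * b'))
       ((a * b' + b * a') + (b * c' + c * b') + c * c')
       ((a * c' + c * a') + b * b' + c * c'))"
text \<open>Nonzero elements satisfy \<open>x^7 = 1\<close>, so the inverse is
  \<open>x^6\<close>.\<close>

definition "inverse (x :: gf8) = (x * x) * (x * x) * (x * x)"
definition "x div y = x * inverse (y :: gf8)"
instance
proof
  fix x y z :: gf8
  note defs = zero_gf8_def one_gf8_def plus_gf8_def uminus_gf8_def minus_gf8_def times_gf8_def
    inverse_gf8_def divide_gf8_def
  show "x * y * z = x * (y * z)" by (cases x; cases y; cases z) (simp only: defs prod.case gf8.case gf8.inject algebra_simps simp_thms)
  show "(x + y) * z = x * z + y * z" by (cases x; cases y; cases z) (simp only: defs prod.case gf8.case gf8.inject algebra_simps simp_thms)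
  show "x + y + z = x + (y + z)" by (cases x; cases y; cases z) (simp only: defs prod.case gf8.case gf8.inject algebra_simps simp_thms)
  show "x * y = y * x" by (cases x; cases y) (simp only: defs prod.case gf8.case gf8.inject algebra_simps simp_thms)
  show "x + y = y + x" by (cases x; cases y) (simp only: defs prod.case gf8.case gf8.inject algebra_simps simp_thms)
  show "x \<noteq> 0 \<Longrightarrow> inverse x * x = 1"
  proof -
    obtain a b c where x: "x = GF8 a b c" by (cases x)
    show "x \<noteq> 0 \<Longrightarrow> inverse x * x = 1"
      unfolding x by (cases a; cases b; cases c) (simp_all add: defs)
  qed
qed (auto simp: zero_gf8_def one_gf8_def plus_gf8_def uminus_gf8_def minus_gf8_def times_gf8_def
    inverse_gf8_def divide_gf8_def split: gf8.split)
end

subsection \<open>Actions of the multiplicative group of GF(8)\<close>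

text \<open>This is the trace \<open>x + x\<^sup>2 + x\<^sup>4\<close> because \<open>\<alpha>\<close> and \<open>\<alpha>\<^sup>2\<close> have trace \<open>0\<close>.\<close>

definition gf8_trace :: "gf8 \<Rightarrow> gf8" where
  "gf8_trace x = (case x of GF8 a b c \<Rightarrow> GF8 a 0 0)"

text \<open>Reading \<open>GF(4)\<^sup>2\<close> over the prime field as \<open>GF(2) \<oplus> GF(8)\<close> makes the multiplicative
  group of \<open>GF(8)\<close> act on it.\<close>

definition act4 :: "gf8 \<Rightarrow> gf4 \<times> gf4 \<Rightarrow> gf4 \<times> gf4" where
  "act4 t u = (case u of (GF4 a e, GF4 b c) \<Rightarrow>
     case t * GF8 a b c of GF8 a' b' c' \<Rightarrow> (GF4 a' e, GF4 b' c'))"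

text \<open>The conjugate of scalar multiplication by the additive bijection
  \<open>(x, y) \<mapsto> (x + Tr (x + y), y + Tr x)\<close>, which was found by computer search; its inverse
  is \<open>(x, y) \<mapsto> (x + Tr y, y + Tr (x + y))\<close>.\<close>

definition act8 :: "gf8 \<Rightarrow> gf8 \<times> gf8 \<Rightarrow> gf8 \<times> gf8" where
  "act8 t u = (case u of (x, y) \<Rightarrow>
     let x' = t * (x + gf8_trace y); y' = t * (y + gf8_trace (x + y))
     in (x' + gf8_trace (x' + y'), y' + gf8_trace x'))"

section \<open>Laws of the two actions\<close>

lemma act4_add: "act4 t (u + v) = act4 t u + act4 t v"
proof -
  obtain a e b c a' e' b' c' p q r where
    "u = (GF4 a e, GF4 b c)" "v = (GF4 a' e', GF4 b' c')" "t = GF8 p q r"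
    by (metis gf4.exhaust gf8.exhaust surj_pair)
  then show ?thesis
    by (simp only: act4_def plus_prod_def fst_conv snd_conv plus_gf4_def times_gf8_def prod.case
        gf4.case gf8.case gf4.inject prod.inject algebra_simps simp_thms)
qed

lemma act4_mult: "act4 (s * t) u = act4 s (act4 t u)"
  by (simp add: act4_def mult.assoc split: gf4.split gf8.split prod.split)

lemma act4_one: "act4 1 u = u"
  by (simp add: act4_def split: gf4.split gf8.split prod.split)

lemma gf8_trace_add: "gf8_trace (x + y) = gf8_trace x + gf8_trace y"
  by (cases x; cases y) (simp add: gf8_trace_def plus_gf8_def)

text \<open>The trace takes values in the prime field, where it is the identity because the degree 3
  is odd.\<close>

lemma gf8_trace_idem: "gf8_trace (gf8_trace x) = gf8_trace x"
  by (cases x) (simp add: gf8_trace_def)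

lemma gf8_add_self: "x + x = 0" for x :: gf8
  by (cases x) (simp add: zero_gf8_def plus_gf8_def)

lemma gf8_add_left_self: "x + (x + y) = y" for x :: gf8
  by (metis add.assoc add_0 gf8_add_self)

lemma act8_add: "act8 t (u + v) = act8 t u + act8 t v"
  by (simp add: act8_def gf8_trace_add plus_prod_def Let_def case_prod_beta algebra_simps)

text \<open>In the composite, the additive bijection of the inner action meets its inverse from the
  outer one. They cancel by idempotence of the trace and characteristic 2, which leaves
  associativity of the product.\<close>

lemma act8_mult: "act8 (s * t) u = act8 s (act8 t u)"
  by (simp add: act8_def gf8_trace_add gf8_trace_idem gf8_add_left_self gf8_add_self Let_def
      case_prod_beta ac_simps)

lemma act8_one: "act8 1 u = u"
  by (cases u) (simp add: act8_def gf8_trace_add gf8_trace_idem gf8_add_left_self gf8_add_self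
      Let_def ac_simps)

text \<open>The conditionals, unlike implications, keep the simplifier from evaluating the
  determinant in the excluded cases.\<close>

lemma det2_act4:
  assumes "t \<noteq> 0" "t \<noteq> 1" "c \<noteq> 0" "c \<noteq> 1" "u \<noteq> 0"
  shows "det2 (act4 t u) (act4 t (scale2 c u)) \<noteq> 0"
proof -
  have "\<forall>t. if t = 0 \<or> t = 1 then True else
    (\<forall>c. if c = 0 \<or> c = 1 then True else
    (\<forall>x y. if x = 0 \<and> y = 0 then True else det2 (act4 t (x, y)) (act4 t (scale2 c (x, y))) \<noteq> 0))"
    by code_simp
  with assms show ?thesis
    by (cases u) (metis zero_prod_def)
qed

lemma det2_act8:
  assumes "t \<noteq> 0" "t \<noteq> 1" "c \<noteq> 0" "c \<noteq> 1" "u \<noteq> 0"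
  shows "det2 (act8 t u) (act8 t (scale2 c u)) \<noteq> 0"
proof -
  \<comment> \<open>The check runs through 6 values of \<open>t\<close>, 6 of \<open>c\<close> and
    63 of \<open>(x, y)\<close>.\<close>
  have "\<forall>t. if t = 0 \<or> t = 1 then True else
    (\<forall>c. if c = 0 \<or> c = 1 then True else
    (\<forall>x y. if x = 0 \<and> y = 0 then True else det2 (act8 t (x, y)) (act8 t (scale2 c (x, y))) \<noteq> 0))"
    by code_simp
  with assms show ?thesis
    by (cases u) (metis zero_prod_def)
qed

text \<open>The seven planes come from the seven nonzero elements of GF(8), although the coordinates
  lie in GF(4).\<close>

lemma seven_orthogoval_planes_order_4:
  "\<exists>(X :: nat set) \<P>. mutually_orthogoval_affine_planes 4 X \<P> \<and>
     (\<forall>P\<in>\<P>. isomorphic_to_AG2 4 P) \<and> card \<P> = 7"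
  using mutually_orthogoval_orbit[of act4] act4_add act4_mult act4_one det2_act4
  by (simp add: card_gf4 card_gf8)

lemma seven_orthogoval_planes_order_8:
  "\<exists>(X :: nat set) \<P>. mutually_orthogoval_affine_planes 8 X \<P> \<and>
     (\<forall>P\<in>\<P>. isomorphic_to_AG2 8 P) \<and> card \<P> = 7"
  using mutually_orthogoval_orbit[of act8] act8_add act8_mult act8_one det2_act8
  by (simp add: card_gf8)

text \<open>The bound includes \<open>finite\<close> because \<open>card\<close> is \<open>0\<close>
  on infinite sets. It is stated over an arbitrary type of points, while the examples live on
  natural numbers.\<close>

theorem theorem3p19:
  "((\<exists>(X :: nat set) \<P>. mutually_orthogoval_affine_planes 4 X \<P> \<and>
        (\<forall>P\<in>\<P>. isomorphic_to_AG2 4 P) \<and> card \<P> = 7) \<and>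
    (\<forall>(X :: 'a set) \<P>. mutually_orthogoval_affine_planes 4 X \<P> \<longrightarrow>
        finite \<P> \<and> card \<P> \<le> 7)) \<and>
   (\<exists>(X :: nat set) \<P>. mutually_orthogoval_affine_planes 8 X \<P> \<and>
        (\<forall>P\<in>\<P>. isomorphic_to_AG2 8 P) \<and> card \<P> = 7)"
proof (intro conjI allI impI)
  fix X :: "'a set" and \<P>
  assume "mutually_orthogoval_affine_planes 4 X \<P>"
  from mutually_orthogoval_affine_planes_bound[OF this]
  show "finite \<P>" "card \<P> \<le> 7"
    by simp_all
qed (fact seven_orthogoval_planes_order_4 seven_orthogoval_planes_order_8)+

end
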